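(* Let $X$ be a compact Hausdorff space, $\Delta_1\subset X$ clopen, and $\alpha:\Delta_1\to X$ continuous with open image $\Delta_{-1}$, and let $(\widetilde X,\widetilde\alpha)$ be the reversible extension of $(X,\alpha)$. For $n\in\mathbb{N}\setminus\{0\}$ let $F_n=\{x\in\Delta_n:\alpha^n(x)=x\}$ and $\widetilde F_n=\{\widetilde x\in\widetilde\Delta_n:\widetilde\alpha^n(\widetilde x)=\widetilde x\}$, where $\Delta_n$, $\widetilde\Delta_n$ are the domains of $\alpha^n$, $\widetilde\alpha^n$. Then $$\widetilde F_n=\{(x_0,x_1,\dots)\in\widetilde X:x_k\in F_n,\ k\in\mathbb{N}\},\qquad n=1,2,\dots,$$ and $\alpha$ is topologically free if and only if $\widetilde\alpha$ is topologically free.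
   Context: $\mathbb{N}=\{0,1,2,\dots\}$. $\Delta_0=X$. Reversible extension: adjoin to $X$ an isolated point $0$. Let $\widetilde X=\bigcup_{N\ge0}X_N\cup X_\infty\subset\prod_{n=0}^\infty(X\cup\{0\})$ with the topology induced from the product topology, where $X_N=\{(x_0,\dots,x_N,0,0,\dots):x_n\in\Delta_n,\ x_N\notin\Delta_{-1},\ \alpha(x_n)=x_{n-1}\text{ for }1\le n\le N\}$ and $X_\infty=\{(x_0,x_1,\dots):x_n\in\Delta_n,\ \alpha(x_n)=x_{n-1}\text{ for }n\ge1\}$. Let $\widetilde\Delta_1=\{(x_0,x_1,\dots)\in\widetilde X:x_0\in\Delta_1\}$ and $\widetilde\alpha:\widetilde\Delta_1\to\widetilde X$, $\widetilde\alpha(x_0,x_1,\dots)=(\alpha(x_0),x_0,x_1,\dots)$. Topological freedom: a continuous partial mapping $\alpha$ of a Hausdorff space, with $F_n$ as in the claim and $\alpha^{-k}(x)=\{y\in\Delta_k:\alpha^k(y)=x\}$, is topologically free if for every $n>0$, every open nonempty subset $V\subset F_n$ contains a point $x$ such that $|\alpha^{-k}(x)|>1$ for some $k\in\{1,\dots,n\}$. The same definition is applied to $\widetilde\alpha$ on $\widetilde X$. *)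

theory Defs
  imports "HOL-Analysis.Analysis"
begin

text \<open>
  A partial mapping of a space \<open>X\<close> is given by its domain \<open>D\<close> (a subset of \<open>topspace X\<close>) and a
  function \<open>\<alpha>\<close>, of which only the values on \<open>D\<close> matter. Its \<open>n\<close>-th power is \<open>\<alpha> ^^ n\<close> restricted to
  the domain \<open>pdom X D \<alpha> n\<close>.
\<close>

primrec pdom :: "'a topology \<Rightarrow> 'a set \<Rightarrow> ('a \<Rightarrow> 'a) \<Rightarrow> nat \<Rightarrow> 'a set" where
  "pdom X D \<alpha> 0 = topspace X"
| "pdom X D \<alpha> (Suc n) = {x \<in> D. \<alpha> x \<in> pdom X D \<alpha> n}"

definition pfix :: "'a topology \<Rightarrow> 'a set \<Rightarrow> ('a \<Rightarrow> 'a) \<Rightarrow> nat \<Rightarrow> 'a set" where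
  "pfix X D \<alpha> n = {x \<in> pdom X D \<alpha> n. (\<alpha> ^^ n) x = x}"

definition ppreimage :: "'a topology \<Rightarrow> 'a set \<Rightarrow> ('a \<Rightarrow> 'a) \<Rightarrow> nat \<Rightarrow> 'a \<Rightarrow> 'a set" where
  "ppreimage X D \<alpha> k x = {y \<in> pdom X D \<alpha> k. (\<alpha> ^^ k) y = x}"

text \<open>
  \<open>V\<close> ranges over the open subsets of \<open>X\<close> contained in the set of fixed points, not over its
  relatively open subsets. The disjunct \<open>infinite\<close> is needed because \<open>card\<close> is \<open>0\<close> on infinite sets.
\<close>

definition topologically_free :: "'a topology \<Rightarrow> 'a set \<Rightarrow> ('a \<Rightarrow> 'a) \<Rightarrow> bool" where
  "topologically_free X D \<alpha> \<longleftrightarrow>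
     (\<forall>n>0. \<forall>V. openin X V \<and> V \<noteq> {} \<and> V \<subseteq> pfix X D \<alpha> n \<longrightarrow>
        (\<exists>x\<in>V. \<exists>k\<in>{1..n}.
           infinite (ppreimage X D \<alpha> k x) \<or> card (ppreimage X D \<alpha> k x) > 1))"

text \<open>The space \<open>X\<close> with an isolated point adjoined; the new point is \<open>None\<close>.\<close>

definition adjoin_isolated :: "'a topology \<Rightarrow> 'a option topology" where
  "adjoin_isolated X =
     topology (\<lambda>U. U \<subseteq> insert None (Some ` topspace X) \<and> openin X {a. Some a \<in> U})"

lemma openin_adjoin_isolated:
  "openin (adjoin_isolated X) U \<longleftrightarrow>
     U \<subseteq> insert None (Some ` topspace X) \<and> openin X {a. Some a \<in> U}"
proof -
  let ?P = "\<lambda>U. U \<subseteq> insert None (Some ` topspace X) \<and> openin X {a. Some a \<in> U}"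
  have "istopology ?P"
    unfolding istopology_def
  proof (intro conjI allI impI)
    fix S T assume "?P S" "?P T"
    moreover have "{a. Some a \<in> S \<inter> T} = {a. Some a \<in> S} \<inter> {a. Some a \<in> T}" by auto
    ultimately show "S \<inter> T \<subseteq> insert None (Some ` topspace X)"
      and "openin X {a. Some a \<in> S \<inter> T}" by auto
  next
    fix K assume K: "\<forall>S\<in>K. ?P S"
    then show "\<Union>K \<subseteq> insert None (Some ` topspace X)" by blast
    have "{a. Some a \<in> \<Union>K} = (\<Union>S\<in>K. {a. Some a \<in> S})" by auto
    then show "openin X {a. Some a \<in> \<Union>K}" using K by auto
  qed
  then show ?thesis
    unfolding adjoin_isolated_def by (simp add: topology_inverse')
qed

lemma topspace_adjoin_isolated:
  "topspace (adjoin_isolated X) = insert None (Some ` topspace X)"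
proof
  show "topspace (adjoin_isolated X) \<subseteq> insert None (Some ` topspace X)"
    using openin_topspace[of "adjoin_isolated X"] unfolding openin_adjoin_isolated by blast
  have "{a. Some a \<in> insert None (Some ` topspace X)} = topspace X" by auto
  then have "openin (adjoin_isolated X) (insert None (Some ` topspace X))"
    unfolding openin_adjoin_isolated by simp
  then show "insert None (Some ` topspace X) \<subseteq> topspace (adjoin_isolated X)"
    by (rule openin_subset)
qed

text \<open>\<open>rev_fin\<close> and \<open>rev_inf\<close> are the sets \<open>X\<^sub>N\<close> and \<open>X\<^sub>\<infinity>\<close>.\<close>

definition rev_fin ::
    "'a topology \<Rightarrow> 'a set \<Rightarrow> ('a \<Rightarrow> 'a) \<Rightarrow> nat \<Rightarrow> (nat \<Rightarrow> 'a option) set" where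
  "rev_fin X D \<alpha> N =
     {s. \<exists>x :: nat \<Rightarrow> 'a.
           (\<forall>n\<le>N. s n = Some (x n)) \<and> (\<forall>n>N. s n = None) \<and>
           (\<forall>n\<le>N. x n \<in> pdom X D \<alpha> n) \<and> x N \<notin> \<alpha> ` D \<and>
           (\<forall>n. 1 \<le> n \<and> n \<le> N \<longrightarrow> \<alpha> (x n) = x (n - 1))}"

definition rev_inf ::
    "'a topology \<Rightarrow> 'a set \<Rightarrow> ('a \<Rightarrow> 'a) \<Rightarrow> (nat \<Rightarrow> 'a option) set" where
  "rev_inf X D \<alpha> =
     {s. \<exists>x :: nat \<Rightarrow> 'a.
           (\<forall>n. s n = Some (x n)) \<and> (\<forall>n. x n \<in> pdom X D \<alpha> n) \<and>
           (\<forall>n\<ge>1. \<alpha> (x n) = x (n - 1))}"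

definition rev_space ::
    "'a topology \<Rightarrow> 'a set \<Rightarrow> ('a \<Rightarrow> 'a) \<Rightarrow> (nat \<Rightarrow> 'a option) topology" where
  "rev_space X D \<alpha> =
     subtopology (product_topology (\<lambda>_. adjoin_isolated X) UNIV)
       ((\<Union>N. rev_fin X D \<alpha> N) \<union> rev_inf X D \<alpha>)"

definition rev_dom ::
    "'a topology \<Rightarrow> 'a set \<Rightarrow> ('a \<Rightarrow> 'a) \<Rightarrow> (nat \<Rightarrow> 'a option) set" where
  "rev_dom X D \<alpha> = {s \<in> topspace (rev_space X D \<alpha>). s 0 \<in> Some ` D}"

definition rev_map :: "('a \<Rightarrow> 'a) \<Rightarrow> (nat \<Rightarrow> 'a option) \<Rightarrow> (nat \<Rightarrow> 'a option)" where
  "rev_map \<alpha> s = case_nat (map_option \<alpha> (s 0)) s"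

lemma topspace_rev_space:
  assumes "D \<subseteq> topspace X"
  shows "topspace (rev_space X D \<alpha>) = (\<Union>N. rev_fin X D \<alpha> N) \<union> rev_inf X D \<alpha>"
proof -
  have pd: "pdom X D \<alpha> n \<subseteq> topspace X" for n
    using assms by (cases n) auto
  have "s n \<in> insert None (Some ` topspace X)"
    if s: "s \<in> (\<Union>N. rev_fin X D \<alpha> N) \<union> rev_inf X D \<alpha>" for s n
    using s
  proof
    assume "s \<in> (\<Union>N. rev_fin X D \<alpha> N)"
    then obtain N x where "\<forall>n\<le>N. s n = Some (x n)" "\<forall>n>N. s n = None"
      "\<forall>n\<le>N. x n \<in> pdom X D \<alpha> n"
      unfolding rev_fin_def by blast
    then show ?thesis using pd by (cases "n \<le> N") (auto intro!: imageI, blast)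
  next
    assume "s \<in> rev_inf X D \<alpha>"
    then show ?thesis using pd unfolding rev_inf_def by blast
  qed
  then show ?thesis
    unfolding rev_space_def by (auto simp: topspace_adjoin_isolated PiE_UNIV_domain)
qed

end

(* The map on the extension is injective (a shift recovers its argument), so it is topologically free
   iff no set of its periodic points has interior. By continuity, every basic open set of the
   extension that meets the n-periodic points contains a nonempty cylinder {s. s m : W} with W open
   in X. If the cylinder consists of n-periodic points, then W consists of n-periodic points of \<alpha>, and
   any two points of an \<alpha>^(-k)(x), x : W, are themselves n-periodic with the same k-th iterate, hence
   equal. Conversely, if V is open, consists of n-periodic points, and all \<alpha>^(-k)(x), x : V, k \<le> n,
   are singletons, then the cylinder {s. s 0 : V} contains only the periodic backward orbits. *)

theory Submission
  imports Defs
begin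

section \<open>Multiplicity as a pair of distinct preimages\<close>

lemma infinite_or_card_gt_1_iff:
  "infinite A \<or> card A > 1 \<longleftrightarrow> (\<exists>y\<in>A. \<exists>z\<in>A. y \<noteq> z)"
proof -
  have "finite A \<and> card A \<le> 1 \<longleftrightarrow> (\<forall>y\<in>A. \<forall>z\<in>A. y = z)"
  proof
    assume "finite A \<and> card A \<le> 1"
    then show "\<forall>y\<in>A. \<forall>z\<in>A. y = z"
      by (metis One_nat_def card_le_Suc0_iff_eq)
  next
    assume *: "\<forall>y\<in>A. \<forall>z\<in>A. y = z"
    then have "A = {} \<or> (\<exists>a. A = {a})" by blast
    then show "finite A \<and> card A \<le> 1" by auto
  qed
  then show ?thesis by (metis not_le)
qed

lemma topologically_free_alt:
  "topologically_free X D \<alpha> \<longleftrightarrow>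
     (\<forall>n>0. \<forall>V. openin X V \<and> V \<noteq> {} \<and> V \<subseteq> pfix X D \<alpha> n \<longrightarrow>
        (\<exists>x\<in>V. \<exists>k\<in>{1..n}. \<exists>y\<in>ppreimage X D \<alpha> k x. \<exists>z\<in>ppreimage X D \<alpha> k x. y \<noteq> z))"
  unfolding topologically_free_def infinite_or_card_gt_1_iff ..

section \<open>Powers of a partial map and of the shift\<close>

lemma funpow_in_pdom: "x \<in> pdom X D \<alpha> (m + n) \<Longrightarrow> (\<alpha> ^^ m) x \<in> pdom X D \<alpha> n"
  by (induction m arbitrary: x) (auto simp: funpow_swap1)

lemma pdom_addI:
  "x \<in> pdom X D \<alpha> m \<Longrightarrow> (\<alpha> ^^ m) x \<in> pdom X D \<alpha> n \<Longrightarrow> x \<in> pdom X D \<alpha> (m + n)"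
  by (induction m arbitrary: x) (auto simp: funpow_swap1)

text \<open>Each application prepends the image of the current head, so \<open>n\<close>
  applications shift \<open>s\<close> by \<open>n\<close> places and fill the gap with iterates of
  \<open>s 0\<close>, the highest first. This holds for arbitrary sequences; a head
  \<open>None\<close> just yields \<open>None\<close>.\<close>

lemma rev_map_funpow:
  "(rev_map \<alpha> ^^ n) s i = (if i < n then map_option (\<alpha> ^^ (n - i)) (s 0) else s (i - n))"
proof (induction n arbitrary: i)
  case (Suc n)
  show ?case
  proof (cases i)
    case 0
    have "(rev_map \<alpha> ^^ Suc n) s 0 = map_option \<alpha> ((rev_map \<alpha> ^^ n) s 0)"
      by (simp add: rev_map_def)
    also have "\<dots> = map_option (\<alpha> ^^ Suc n) (s 0)"
      using Suc[of 0] by (auto simp: option.map_comp comp_def option.map_id0)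
    finally show ?thesis using 0 by (simp del: funpow.simps)
  next
    case (Suc j)
    then show ?thesis using Suc.IH[of j] by (simp add: rev_map_def)
  qed
qed simp

context
  fixes X :: "'a topology" and D :: "'a set" and \<alpha> :: "'a \<Rightarrow> 'a"
  assumes dom: "D \<subseteq> topspace X" and img: "\<alpha> ` D \<subseteq> topspace X"
begin

section \<open>Domains of powers and periodic points\<close>

lemma pdom_subset_topspace: "pdom X D \<alpha> n \<subseteq> topspace X"
  using dom by (cases n) auto

lemma pdom_antimono: "m \<le> n \<Longrightarrow> pdom X D \<alpha> n \<subseteq> pdom X D \<alpha> m"
proof -
  have "pdom X D \<alpha> (m + k) \<subseteq> pdom X D \<alpha> m" for k
  proof (induction m)
    case 0 show ?case using pdom_subset_topspace by simp
  qed auto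
  then show "m \<le> n \<Longrightarrow> ?thesis" by (metis le_add_diff_inverse)
qed

text \<open>A periodic point can run through its cycle any number of times; \<open>m\<close> rounds
  already make \<open>m * n\<close>, hence at least \<open>m\<close>, steps.\<close>

lemma pfix_pdom:
  assumes "x \<in> pfix X D \<alpha> n" "0 < n" shows "x \<in> pdom X D \<alpha> m"
proof -
  have x: "x \<in> pdom X D \<alpha> n" "(\<alpha> ^^ n) x = x"
    using assms(1) by (auto simp: pfix_def)
  have "x \<in> pdom X D \<alpha> (j * n)" for j
    by (induction j) (use x pdom_subset_topspace in \<open>auto intro!: pdom_addI\<close>)
  moreover have "m \<le> m * n" using assms(2) by simp
  ultimately show ?thesis using pdom_antimono by blast
qed

lemma pfix_funpow:
  assumes "x \<in> pfix X D \<alpha> n" "0 < n" shows "(\<alpha> ^^ m) x \<in> pfix X D \<alpha> n"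
proof -
  have "(\<alpha> ^^ n) x = x" using assms(1) by (auto simp: pfix_def)
  moreover have "(\<alpha> ^^ n) ((\<alpha> ^^ m) x) = (\<alpha> ^^ m) ((\<alpha> ^^ n) x)"
    by (metis add.commute comp_apply funpow_add)
  ultimately show ?thesis
    using funpow_in_pdom[OF pfix_pdom[OF assms]] by (auto simp: pfix_def)
qed

section \<open>Points of the extension as backward orbits\<close>

lemma topspace_rev_space_local:
  "s \<in> topspace (rev_space X D \<alpha>) \<longleftrightarrow>
     s 0 \<in> Some ` topspace X \<and>
     (\<forall>i. case s (Suc i) of None \<Rightarrow> s i \<notin> Some ` \<alpha> ` D | Some y \<Rightarrow> y \<in> D \<and> s i = Some (\<alpha> y))"
    (is "_ \<longleftrightarrow> ?R")
proof
  assume "s \<in> topspace (rev_space X D \<alpha>)"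
  then consider N where "s \<in> rev_fin X D \<alpha> N" | "s \<in> rev_inf X D \<alpha>"
    unfolding topspace_rev_space[OF dom] by blast
  then show ?R
  proof cases
    case 1
    then obtain x where x: "\<And>n. n \<le> N \<Longrightarrow> s n = Some (x n)" "\<And>n. n > N \<Longrightarrow> s n = None"
      "\<And>n. n \<le> N \<Longrightarrow> x n \<in> pdom X D \<alpha> n" "x N \<notin> \<alpha> ` D"
      "\<And>n. 1 \<le> n \<Longrightarrow> n \<le> N \<Longrightarrow> \<alpha> (x n) = x (n - 1)"
      unfolding rev_fin_def by blast
    have "case s (Suc i) of None \<Rightarrow> s i \<notin> Some ` \<alpha> ` D | Some y \<Rightarrow> y \<in> D \<and> s i = Some (\<alpha> y)" for i
    proof -
      consider "i < N" | "i = N" | "i > N" by linarith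
      then show ?thesis
      proof cases
        case 1
        then show ?thesis using x(1)[of i] x(1)[of "Suc i"] x(3)[of "Suc i"] x(5)[of "Suc i"] by auto
      next
        case 2
        then show ?thesis using x(1)[of i] x(2)[of "Suc i"] x(4) by auto
      next
        case 3
        then show ?thesis using x(2)[of i] x(2)[of "Suc i"] by auto
      qed
    qed
    moreover have "s 0 \<in> Some ` topspace X" using x(1)[of 0] x(3)[of 0] by auto
    ultimately show ?thesis by blast
  next
    case 2
    then obtain x where x: "\<And>n. s n = Some (x n)" "\<And>n. x n \<in> pdom X D \<alpha> n"
      "\<And>n. 1 \<le> n \<Longrightarrow> \<alpha> (x n) = x (n - 1)"
      unfolding rev_inf_def by blast
    have "s 0 \<in> Some ` topspace X" using x(1)[of 0] x(2)[of 0] by auto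
    moreover have "x (Suc i) \<in> D \<and> \<alpha> (x (Suc i)) = x i" for i
      using x(2)[of "Suc i"] x(3)[of "Suc i"] by auto
    ultimately show ?thesis using x(1) by auto
  qed
next
  assume R: ?R
  then have loc: "case s (Suc i) of None \<Rightarrow> s i \<notin> Some ` \<alpha> ` D | Some y \<Rightarrow> y \<in> D \<and> s i = Some (\<alpha> y)" for i
    by blast
  have s0: "s 0 \<in> Some ` topspace X" using R by blast
  \<comment> \<open>The value of \<open>the None\<close> past the end of a finite orbit does not
    matter: \<open>rev_fin\<close> constrains \<open>x\<close> only up to \<open>N\<close>.\<close>
  define x where "x = (\<lambda>n. the (s n))"
  have step: "x (Suc n) \<in> D \<and> s n = Some (x n) \<and> \<alpha> (x (Suc n)) = x n" if "s (Suc n) \<noteq> None" for n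
    using that loc[of n] by (auto simp: x_def)
  have mem: "x n \<in> pdom X D \<alpha> n" if "s n \<noteq> None" for n
    using that
  proof (induction n)
    case 0
    then show ?case using s0 by (auto simp: x_def)
  next
    case (Suc n)
    then show ?case using step[of n] by auto
  qed
  show "s \<in> topspace (rev_space X D \<alpha>)"
  proof (cases "\<exists>n. s n = None")
    case False
    then have "s \<in> rev_inf X D \<alpha>"
      unfolding rev_inf_def using step mem
      by (auto intro!: exI[of _ x] simp: x_def gr0_conv_Suc Suc_le_eq)
    then show ?thesis unfolding topspace_rev_space[OF dom] by blast
  next
    case True
    \<comment> \<open>\<open>M\<close> is the first gap. A point forces a point before it, so only
      \<open>None\<close> follows \<open>M\<close>. As \<open>s 0\<close> is a point, there is a
      last point, at \<open>N\<close>, and the local condition there puts it outside the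
      image.\<close>
    define M where "M = (LEAST n. s n = None)"
    have M: "s M = None" unfolding M_def using True by (rule LeastI_ex)
    have below: "s n \<noteq> None" if "n < M" for n
      using that not_less_Least unfolding M_def by blast
    obtain N where N: "M = Suc N" using M s0 by (cases M) auto
    have above: "s (M + j) = None" for j
    proof (induction j)
      case (Suc j)
      then show ?case using step[of "M + j"] by (cases "s (Suc (M + j))") auto
    qed (use M in simp)
    have "x N \<notin> \<alpha> ` D"
      using loc[of N] M N below[of N] by (auto simp: x_def)
    moreover have "s n = None" if "n > N" for n
      using above[of "n - M"] that N by simp
    moreover have "\<alpha> (x n) = x (n - 1)" if "1 \<le> n" "n \<le> N" for n
      using step[of "n - 1"] below[of n] that N by auto
    ultimately have "s \<in> rev_fin X D \<alpha> N"
      unfolding rev_fin_def using below mem N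
      by (auto intro!: exI[of _ x] simp: x_def less_Suc_eq_le)
    then show ?thesis unfolding topspace_rev_space[OF dom] by blast
  qed
qed

lemma rev_space_step:
  "s \<in> topspace (rev_space X D \<alpha>) \<Longrightarrow>
     case s (Suc i) of None \<Rightarrow> s i \<notin> Some ` \<alpha> ` D | Some y \<Rightarrow> y \<in> D \<and> s i = Some (\<alpha> y)"
  unfolding topspace_rev_space_local by blast

text \<open>An entry determines all earlier ones: each step towards the head applies \<alpha>.
  Arriving at \<open>s 0\<close> without leaving \<open>D\<close> shows how often the entry can be
  iterated.\<close>

lemma rev_space_SomeD:
  assumes "s \<in> topspace (rev_space X D \<alpha>)" "s (i + k) = Some y"
  shows "y \<in> pdom X D \<alpha> (i + k) \<and> s i = Some ((\<alpha> ^^ k) y)"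
proof -
  have step: "y \<in> D \<and> s i = Some (\<alpha> y)" if "s (Suc i) = Some y" for i y
    using rev_space_step[OF assms(1), of i] that by simp
  have "y \<in> pdom X D \<alpha> n" if "s n = Some y" for n y
    using that
  proof (induction n arbitrary: y)
    case 0
    then show ?case using assms(1) unfolding topspace_rev_space_local by auto
  next
    case (Suc n)
    then show ?case using step by auto
  qed
  moreover have "s (i + k) = Some y \<Longrightarrow> s i = Some ((\<alpha> ^^ k) y)" for y
  proof (induction k arbitrary: y)
    case (Suc k)
    then show ?case using step[of "i + k" y] by (auto simp: funpow_swap1)
  qed simp
  ultimately show ?thesis using assms(2) by auto
qed

section \<open>The extended map, its domains and its periodic points\<close>

lemma rev_map_in_rev_space:
  assumes "s \<in> rev_dom X D \<alpha>"
  shows "rev_map \<alpha> s \<in> topspace (rev_space X D \<alpha>)"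
proof -
  obtain x where x: "s 0 = Some x" "x \<in> D" and s: "s \<in> topspace (rev_space X D \<alpha>)"
    using assms by (auto simp: rev_dom_def)
  have "case rev_map \<alpha> s (Suc i) of None \<Rightarrow> rev_map \<alpha> s i \<notin> Some ` \<alpha> ` D
        | Some y \<Rightarrow> y \<in> D \<and> rev_map \<alpha> s i = Some (\<alpha> y)" for i
  proof (cases i)
    case 0
    then show ?thesis using x by (simp add: rev_map_def)
  next
    case (Suc j)
    have eq: "rev_map \<alpha> s (Suc (Suc j)) = s (Suc j)" "rev_map \<alpha> s (Suc j) = s j"
      by (simp_all add: rev_map_def)
    have "case s (Suc j) of None \<Rightarrow> s j \<notin> Some ` \<alpha> ` D | Some y \<Rightarrow> y \<in> D \<and> s j = Some (\<alpha> y)"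
      using s by (rule rev_space_step)
    then show ?thesis unfolding Suc eq .
  qed
  then show ?thesis
    using img x unfolding topspace_rev_space_local by (auto simp: rev_map_def)
qed

text \<open>The head of \<open>rev_map \<alpha> s\<close> is the image of the head of
  \<open>s\<close>, so how often the extended map can be applied is decided by the head
  alone.\<close>

lemma pdom_rev_space:
  "pdom (rev_space X D \<alpha>) (rev_dom X D \<alpha>) (rev_map \<alpha>) n =
     {s \<in> topspace (rev_space X D \<alpha>). s 0 \<in> Some ` pdom X D \<alpha> n}"
proof (induction n)
  case 0
  show ?case by (auto simp: topspace_rev_space_local)
next
  case (Suc n)
  have "s 0 \<in> Some ` D \<and> rev_map \<alpha> s 0 \<in> Some ` pdom X D \<alpha> n \<longleftrightarrow> s 0 \<in> Some ` pdom X D \<alpha> (Suc n)"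
    for s :: "nat \<Rightarrow> 'a option" by (auto simp: rev_map_def)
  then show ?case
    using Suc rev_map_in_rev_space by (auto simp: rev_dom_def)
qed

text \<open>Being fixed by the \<open>n\<close>-th power means that the entries repeat with period
  \<open>n\<close>. The entry at \<open>k\<close> is also the \<open>n\<close>-th iterate of the one
  at \<open>k + n\<close>, so repetition amounts to every entry being an \<open>n\<close>-periodic
  point.\<close>

lemma pfix_rev_space:
  assumes "0 < n"
  shows "pfix (rev_space X D \<alpha>) (rev_dom X D \<alpha>) (rev_map \<alpha>) n =
            {s \<in> topspace (rev_space X D \<alpha>). \<forall>k. s k \<in> Some ` pfix X D \<alpha> n}" (is "?L = ?R")
proof (intro equalityI subsetI)
  fix s assume "s \<in> ?L"
  then have s: "s \<in> topspace (rev_space X D \<alpha>)" and s0: "s 0 \<noteq> None"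
    and fixed: "(rev_map \<alpha> ^^ n) s = s"
    by (auto simp: pfix_def pdom_rev_space)
  have per: "s (k + n) = s k" for k
    using rev_map_funpow[where \<alpha>=\<alpha> and n=n and s=s and i="k + n"] fixed by simp
  \<comment> \<open>The head, a point, recurs at every multiple of \<open>n\<close>. Since
    \<open>k * n\<close> is at least \<open>k\<close>, a point stands at or after \<open>k\<close>,
    which forces one at \<open>k\<close>.\<close>
  have some: "s k \<noteq> None" for k
  proof -
    have "s (j * n) \<noteq> None" for j
    proof (induction j)
      case (Suc j)
      then show ?case using per[of "j * n"] by (simp add: add.commute)
    qed (use s0 in simp)
    moreover have "k * n = k + (k * n - k)" using assms by (cases n) auto
    ultimately show ?thesis using rev_space_SomeD[OF s, of k "k * n - k"]
      by (metis not_None_eq)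
  qed
  have "s k \<in> Some ` pfix X D \<alpha> n" for k
  proof -
    obtain y where y: "s (k + n) = Some y" using some by blast
    then show ?thesis
      using rev_space_SomeD[OF s y] per[of k] pdom_antimono[of n "k + n"] by (auto simp: pfix_def)
  qed
  then show "s \<in> ?R" using s by blast
next
  fix s assume "s \<in> ?R"
  then have s: "s \<in> topspace (rev_space X D \<alpha>)" and F: "\<And>k. s k \<in> Some ` pfix X D \<alpha> n" by auto
  have per: "s (k + n) = s k" for k
  proof -
    obtain y where y: "s (k + n) = Some y" "y \<in> pfix X D \<alpha> n" using F by blast
    then show ?thesis using rev_space_SomeD[OF s y(1)] by (simp add: pfix_def)
  qed
  have "(rev_map \<alpha> ^^ n) s i = s i" for i
  proof (cases "i < n")
    case True
    \<comment> \<open>The prepended entry at \<open>i\<close> is the iterate of order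
      \<open>n - i\<close> of \<open>s 0\<close>. As \<open>s 0\<close> equals \<open>s n\<close>,
      that is what walking back from \<open>n\<close> to \<open>i\<close> gives.\<close>
    obtain y where y: "s n = Some y" using F by blast
    moreover from this have "s 0 = Some y" using per[of 0] by simp
    ultimately show ?thesis
      using True rev_space_SomeD[OF s, of i "n - i" y] by (simp add: rev_map_funpow)
  next
    case False
    then show ?thesis using per[of "i - n"] by (simp add: rev_map_funpow)
  qed
  then have "(rev_map \<alpha> ^^ n) s = s" by blast
  moreover have "s 0 \<in> Some ` pdom X D \<alpha> n" using F[of 0] by (auto simp: pfix_def)
  ultimately show "s \<in> ?L" using s by (simp add: pfix_def pdom_rev_space)
qed

section \<open>Injectivity and freedom of the extended map\<close>

lemma ppreimage_rev_space_unique: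
  assumes "t \<in> ppreimage X' D' (rev_map \<alpha>) k s" "u \<in> ppreimage X' D' (rev_map \<alpha>) k s"
  shows "t = u"
proof
  fix i
  \<comment> \<open>Reading the \<open>k\<close>-th power \<open>k\<close> places further along
    skips the prepended entries.\<close>
  have "(rev_map \<alpha> ^^ k) t (i + k) = (rev_map \<alpha> ^^ k) u (i + k)"
    using assms by (simp add: ppreimage_def)
  then show "t i = u i" by (simp add: rev_map_funpow)
qed

text \<open>No fibre of a power of an injective map has two points, so freedom can hold only because
  there are no nonempty open sets to test.\<close>

lemma topologically_free_rev_space_iff:
  "topologically_free (rev_space X D \<alpha>) (rev_dom X D \<alpha>) (rev_map \<alpha>) \<longleftrightarrow>
     (\<forall>n>0. \<forall>V. openin (rev_space X D \<alpha>) V \<longrightarrow>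
        V \<subseteq> pfix (rev_space X D \<alpha>) (rev_dom X D \<alpha>) (rev_map \<alpha>) n \<longrightarrow> V = {})"
proof -
  have "(\<exists>y\<in>ppreimage X' D' (rev_map \<alpha>) k s. \<exists>z\<in>ppreimage X' D' (rev_map \<alpha>) k s. y \<noteq> z) = False"
    for X' D' k s using ppreimage_rev_space_unique by blast
  then show ?thesis unfolding topologically_free_alt by (simp only: bex_simps) blast
qed

text \<open>Choosing preimages one after another from \<open>x\<close>, until a point without
  preimage is met, gives an element with head \<open>x\<close>. Then \<open>m\<close> applications
  of the extended map, permitted by the hypothesis on \<open>x\<close>, push \<open>x\<close> to
  index \<open>m\<close>.\<close>

lemma ex_rev_space_at:
  assumes "x \<in> pdom X D \<alpha> m"
  shows "\<exists>s\<in>topspace (rev_space X D \<alpha>). s m = Some x"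
proof -
  define s where "s = rec_nat (Some x) (\<lambda>_ r. case r of None \<Rightarrow> None
     | Some y \<Rightarrow> if y \<in> \<alpha> ` D then Some (inv_into D \<alpha> y) else None)"
  have s: "s 0 = Some x" "\<And>i. s (Suc i) = (case s i of None \<Rightarrow> None
     | Some y \<Rightarrow> if y \<in> \<alpha> ` D then Some (inv_into D \<alpha> y) else None)"
    by (simp_all add: s_def)
  have "s \<in> topspace (rev_space X D \<alpha>)"
    unfolding topspace_rev_space_local
    using assms pdom_subset_topspace s(1)
    by (auto simp: s(2) inv_into_into f_inv_into_f split: option.split)
  \<comment> \<open>With the exponent written as \<open>m + 0\<close>, \<open>funpow_in_pdom\<close>
    lands in the domain of the zeroth power, which is the whole extension.\<close>
  then have "s \<in> pdom (rev_space X D \<alpha>) (rev_dom X D \<alpha>) (rev_map \<alpha>) (m + 0)"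
    using assms s(1) by (simp add: pdom_rev_space)
  from funpow_in_pdom[OF this] show ?thesis
    using s(1) by (intro bexI[of _ "(rev_map \<alpha> ^^ m) s"]) (auto simp: rev_map_funpow)
qed

section \<open>Freedom passes to the extension\<close>

context
  assumes D_open: "openin X D" and cont: "continuous_map (subtopology X D) X \<alpha>"
begin

text \<open>Continuity gives openness relative to \<open>D\<close> at each step; as \<open>D\<close>
  is open, this is openness in \<open>X\<close>, and the induction can go on.\<close>

lemma openin_funpow_preimage:
  assumes "openin X U"
  shows "openin X {x \<in> pdom X D \<alpha> k. (\<alpha> ^^ k) x \<in> U}"
proof (induction k)
  case 0
  have "{x \<in> topspace X. x \<in> U} = U" using openin_subset[OF assms] by blast
  then show ?case using assms by simp
next
  case (Suc k)
  have "{x \<in> pdom X D \<alpha> (Suc k). (\<alpha> ^^ Suc k) x \<in> U} =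
      {x \<in> topspace (subtopology X D). \<alpha> x \<in> {x \<in> pdom X D \<alpha> k. (\<alpha> ^^ k) x \<in> U}}"
    using dom by (auto simp: funpow_swap1)
  moreover have "openin (subtopology X D) \<dots>"
    by (rule openin_continuous_map_preimage[OF cont Suc])
  ultimately show ?case using D_open by (metis openin_trans_full)
qed

text \<open>A basic product neighbourhood constrains finitely many coordinates. The entry at the
  largest of their indices determines the others, so all constraints become open conditions on that
  one entry.\<close>

lemma openin_rev_space_cylinder:
  assumes "openin (rev_space X D \<alpha>) V" "s \<in> V" "\<And>i. s i \<noteq> None"
  obtains m W where "openin X W" "W \<noteq> {}" "W \<subseteq> pdom X D \<alpha> m"
    "\<And>t. t \<in> topspace (rev_space X D \<alpha>) \<Longrightarrow> t m \<in> Some ` W \<Longrightarrow> t \<in> V"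
proof -
  have s: "s \<in> topspace (rev_space X D \<alpha>)" using assms openin_subset by blast
  obtain B where B: "openin (product_topology (\<lambda>_. adjoin_isolated X) UNIV) B"
    and V: "V = B \<inter> ((\<Union>N. rev_fin X D \<alpha> N) \<union> rev_inf X D \<alpha>)"
    using assms(1) unfolding rev_space_def openin_subtopology by blast
  obtain U where fin: "finite {i. U i \<noteq> topspace (adjoin_isolated X)}"
    and U: "\<And>i. openin (adjoin_isolated X) (U i)" and sU: "s \<in> Pi\<^sub>E UNIV U" and UB: "Pi\<^sub>E UNIV U \<subseteq> B"
  proof -
    have "\<exists>U. finite {i \<in> UNIV. U i \<noteq> topspace (adjoin_isolated X)} \<and>
      (\<forall>i\<in>UNIV. openin (adjoin_isolated X) (U i)) \<and> s \<in> Pi\<^sub>E UNIV U \<and> Pi\<^sub>E UNIV U \<subseteq> B"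
      using B assms(2) unfolding V openin_product_topology_alt by blast
    then show ?thesis using that by auto
  qed
  obtain m where m: "\<And>i. U i \<noteq> topspace (adjoin_isolated X) \<Longrightarrow> i \<le> m"
    using fin unfolding finite_nat_set_iff_bounded_le by blast
  \<comment> \<open>\<open>P i\<close> is the constraint at index \<open>i\<close> moved to index
    \<open>m\<close>; \<open>P 0\<close> also keeps \<open>W\<close> inside the domain of the
    \<open>m\<close>-th power.\<close>
  define P where "P = (\<lambda>i. {x \<in> pdom X D \<alpha> (m - i). (\<alpha> ^^ (m - i)) x \<in> {a. Some a \<in> U i}})"
  define W where "W = (\<Inter>i\<in>{..m}. P i)"
  show ?thesis
  proof
    have "openin X (P i)" for i
      unfolding P_def using U[of i] by (intro openin_funpow_preimage) (simp add: openin_adjoin_isolated)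
    then show "openin X W" unfolding W_def by (intro openin_Inter) auto
    obtain y where y: "s m = Some y" using assms(3) by blast
    have "y \<in> P i" if "i \<le> m" for i
    proof -
      have "s i = Some ((\<alpha> ^^ (m - i)) y)" "y \<in> pdom X D \<alpha> m"
        using rev_space_SomeD[OF s, of i "m - i"] y that by auto
      then show ?thesis
        using sU pdom_antimono[of "m - i" m] unfolding P_def PiE_UNIV_domain
        by (auto simp: Pi_iff) (metis)
    qed
    then show "W \<noteq> {}" unfolding W_def by blast
    have "W \<subseteq> P 0" unfolding W_def by blast
    then show "W \<subseteq> pdom X D \<alpha> m" by (auto simp: P_def)
    fix t assume t: "t \<in> topspace (rev_space X D \<alpha>)" "t m \<in> Some ` W"
    then obtain x where x: "t m = Some x" "x \<in> W" by blast
    have "t i \<in> U i" for i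
    proof (cases "i \<le> m")
      case True
      then show ?thesis
        using rev_space_SomeD[OF t(1), of i "m - i" x] x by (auto simp: W_def P_def)
    next
      case False
      then show ?thesis using m[of i] False t(1)
        unfolding rev_space_def by (auto simp: PiE_UNIV_domain Pi_iff)
    qed
    then show "t \<in> V"
      using UB t(1) unfolding V topspace_rev_space[OF dom] by blast
  qed
qed

lemma topologically_free_imp_rev_space:
  assumes "topologically_free X D \<alpha>"
  shows "topologically_free (rev_space X D \<alpha>) (rev_dom X D \<alpha>) (rev_map \<alpha>)"
  unfolding topologically_free_rev_space_iff
proof (intro allI impI, rule ccontr)
  fix n :: nat and V
  assume n: "0 < n" and V: "openin (rev_space X D \<alpha>) V" "V \<noteq> {}"
    "V \<subseteq> pfix (rev_space X D \<alpha>) (rev_dom X D \<alpha>) (rev_map \<alpha>) n"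
  have F: "s k \<in> Some ` pfix X D \<alpha> n" if "s \<in> V" for s k
    using that V(3) unfolding pfix_rev_space[OF n] by blast
  obtain s where s: "s \<in> V" using V(2) by blast
  have some: "s i \<noteq> None" for i using F[OF s, of i] by blast
  obtain m W where W: "openin X W" "W \<noteq> {}" "W \<subseteq> pdom X D \<alpha> m"
    "\<And>t. t \<in> topspace (rev_space X D \<alpha>) \<Longrightarrow> t m \<in> Some ` W \<Longrightarrow> t \<in> V"
    by (rule openin_rev_space_cylinder[OF V(1) s some]) (rule that; assumption)
  \<comment> \<open>Such a \<open>y\<close> stands at index \<open>m + k\<close> of some
    \<open>t\<close>. The entry of \<open>t\<close> at \<open>m\<close> is then in \<open>W\<close>,
    so \<open>t\<close> is in \<open>V\<close> and all its entries are periodic.\<close>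
  have key: "y \<in> pfix X D \<alpha> n" if y: "y \<in> pdom X D \<alpha> k" "(\<alpha> ^^ k) y \<in> W" for k y
  proof -
    have "y \<in> pdom X D \<alpha> (m + k)"
      using pdom_addI[OF y(1), where n=m] W(3) y(2) by (auto simp: add.commute)
    then obtain t where t: "t \<in> topspace (rev_space X D \<alpha>)" "t (m + k) = Some y"
      using ex_rev_space_at by blast
    then have "t \<in> V" using W(4) rev_space_SomeD y(2) by blast
    then show ?thesis using F[of t "m + k"] t(2) by auto
  qed
  have "W \<subseteq> pfix X D \<alpha> n" using key[of _ 0] openin_subset[OF W(1)] by auto
  then obtain x k y z where x: "x \<in> W" "k \<in> {1..n}" "y \<noteq> z"
    "y \<in> ppreimage X D \<alpha> k x" "z \<in> ppreimage X D \<alpha> k x"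
    using assms n W(1,2) unfolding topologically_free_alt by meson
  \<comment> \<open>By \<open>key\<close>, \<open>w\<close> is periodic, so the remaining
    \<open>n - k\<close> steps of its cycle lead from \<open>x\<close> back to
    \<open>w\<close>.\<close>
  have "w = (\<alpha> ^^ (n - k)) x" if "w \<in> ppreimage X D \<alpha> k x" for w
  proof -
    have "w \<in> pfix X D \<alpha> n" "(\<alpha> ^^ k) w = x" using key that x(1) by (auto simp: ppreimage_def)
    moreover have "(\<alpha> ^^ n) w = (\<alpha> ^^ (n - k)) ((\<alpha> ^^ k) w)"
      using x(2) by (metis atLeastAtMost_iff comp_apply funpow_add le_add_diff_inverse2)
    ultimately show ?thesis by (simp add: pfix_def)
  qed
  then show False using x by blast
qed

end

section \<open>Freedom descends from the extension\<close>

lemma rev_space_topologically_free_imp: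
  assumes "topologically_free (rev_space X D \<alpha>) (rev_dom X D \<alpha>) (rev_map \<alpha>)"
  shows "topologically_free X D \<alpha>"
  unfolding topologically_free_alt
proof (intro allI impI, rule ccontr)
  fix n :: nat and V
  assume n: "0 < n" and "openin X V \<and> V \<noteq> {} \<and> V \<subseteq> pfix X D \<alpha> n"
  then have V: "openin X V" "V \<noteq> {}" "V \<subseteq> pfix X D \<alpha> n" by auto
  assume "\<not> (\<exists>x\<in>V. \<exists>k\<in>{1..n}. \<exists>y\<in>ppreimage X D \<alpha> k x. \<exists>z\<in>ppreimage X D \<alpha> k x. y \<noteq> z)"
  then have uniq: "\<And>x k y z. \<lbrakk>x \<in> V; 1 \<le> k; k \<le> n; y \<in> ppreimage X D \<alpha> k x;
     z \<in> ppreimage X D \<alpha> k x\<rbrakk> \<Longrightarrow> y = z"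
    by (meson atLeastAtMost_iff)
  \<comment> \<open>Uniqueness is known for exponents up to \<open>n\<close> only. For
    \<open>k > n\<close>, the iterate of order \<open>k - n\<close> of a preimage is an
    \<open>n\<close>-fold preimage of \<open>x\<close>. So is \<open>x\<close> itself; hence they
    agree and the exponent drops to \<open>k - n\<close>.\<close>
  have uniq_all: "y = z" if "x \<in> V" "y \<in> ppreimage X D \<alpha> k x" "z \<in> ppreimage X D \<alpha> k x" for x k y z
    using that(2,3)
  proof (induction k arbitrary: y z rule: less_induct)
    case (less k)
    consider "k = 0" | "1 \<le> k" "k \<le> n" | "n < k" by linarith
    then show ?case
    proof cases
      case 1
      then show ?thesis using less.prems by (simp add: ppreimage_def)
    next
      case 2
      then show ?thesis using uniq[OF that(1)] less.prems by blast
    next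
      case 3
      have xx: "x \<in> ppreimage X D \<alpha> n x" using that(1) V(3) by (auto simp: pfix_def ppreimage_def)
      have "w \<in> ppreimage X D \<alpha> (k - n) x" if w: "w \<in> ppreimage X D \<alpha> k x" for w
      proof -
        have wk: "w \<in> pdom X D \<alpha> ((k - n) + n)" "w \<in> pdom X D \<alpha> (k - n)"
          using w 3 pdom_antimono[of "k - n" k] by (auto simp: ppreimage_def)
        moreover have "(\<alpha> ^^ n) ((\<alpha> ^^ (k - n)) w) = x"
          using w 3 by (simp add: ppreimage_def flip: funpow_add[THEN fun_cong, unfolded comp_apply])
        ultimately have "(\<alpha> ^^ (k - n)) w \<in> ppreimage X D \<alpha> n x"
          using funpow_in_pdom[OF wk(1)] by (simp add: ppreimage_def)
        then have "(\<alpha> ^^ (k - n)) w = x" using uniq[OF \<open>x \<in> V\<close> _ _ _ xx] n by simp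
        then show ?thesis using wk(2) by (simp add: ppreimage_def)
      qed
      then show ?thesis using less.IH[of "k - n"] less.prems 3 n by auto
    qed
  qed
  \<comment> \<open>On a cycle whose length divides \<open>n\<close>, one step back is
    \<open>n - 1\<close> steps forward; so the claimed entry lies \<open>m\<close> steps before
    \<open>x\<close> on its cycle.\<close>
  have orbit: "s m = Some ((\<alpha> ^^ (m * (n - 1))) x)"
    if x: "x \<in> V" "s 0 = Some x" and s: "s \<in> topspace (rev_space X D \<alpha>)" for s x m
  proof (induction m)
    case (Suc m)
    let ?b = "\<lambda>m. (\<alpha> ^^ (m * (n - 1))) x"
    have xF: "x \<in> pfix X D \<alpha> n" using x V(3) by blast
    have b_Suc: "\<alpha> (?b (Suc m)) = ?b m" for m
    proof -
      have "\<alpha> (?b (Suc m)) = (\<alpha> ^^ (m * (n - 1) + n)) x"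
        using n by (cases n) (simp_all add: add_ac)
      also have "\<dots> = ?b m" using xF by (simp add: funpow_add pfix_def)
      finally show ?thesis .
    qed
    have bF: "?b m \<in> pfix X D \<alpha> n" for m using pfix_funpow[OF xF n] .
    have "?b (Suc m) \<in> D" using pfix_pdom[OF bF n, of "Suc m" 1] by simp
    \<comment> \<open>The periodic point at \<open>m\<close> has a preimage in \<open>D\<close>, so
      the sequence cannot end there.\<close>
    then have "s m \<in> Some ` \<alpha> ` D" using Suc b_Suc by (metis image_eqI)
    then obtain y where y: "s (Suc m) = Some y"
      using rev_space_step[OF s, of m] by (cases "s (Suc m)") auto
    have "(\<alpha> ^^ k) (?b k) = x" for k
    proof (induction k)
      case (Suc k)
      then show ?case using b_Suc[of k] by (simp add: funpow_swap1)
    qed simp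
    \<comment> \<open>The next entry and the point of the cycle are both preimages of
      \<open>x\<close> of order \<open>Suc m\<close>, so \<open>uniq_all\<close> identifies
      them.\<close>
    then have "?b (Suc m) \<in> ppreimage X D \<alpha> (Suc m) x"
      unfolding ppreimage_def using pfix_pdom[OF bF n] by blast
    moreover have "y \<in> ppreimage X D \<alpha> (Suc m) x"
      using rev_space_SomeD[OF s, of 0 "Suc m" y] y x(2) unfolding ppreimage_def by auto
    ultimately show ?case using uniq_all[OF x(1)] y by blast
  qed (use x in simp)
  define C where "C = {s \<in> topspace (rev_space X D \<alpha>). s 0 \<in> Some ` V}"
  have "openin (adjoin_isolated X) (Some ` V)"
    using V(1) openin_subset[OF V(1)] unfolding openin_adjoin_isolated by (auto simp: image_iff)
  moreover have "continuous_map (rev_space X D \<alpha>) (adjoin_isolated X) (\<lambda>s. s 0)"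
    unfolding rev_space_def
    by (intro continuous_map_from_subtopology continuous_map_product_projection) simp
  ultimately have "openin (rev_space X D \<alpha>) C"
    unfolding C_def by (rule openin_continuous_map_preimage[rotated])
  moreover have "C \<noteq> {}"
  proof -
    obtain x where "x \<in> V" using V(2) by blast
    then show ?thesis
      using ex_rev_space_at[of x 0] openin_subset[OF V(1)] unfolding C_def by (auto simp: subset_iff)
  qed
  moreover have "C \<subseteq> pfix (rev_space X D \<alpha>) (rev_dom X D \<alpha>) (rev_map \<alpha>) n"
  proof
    fix s assume "s \<in> C"
    then obtain x where x: "x \<in> V" "s 0 = Some x" and s: "s \<in> topspace (rev_space X D \<alpha>)"
      unfolding C_def by blast
    have "s k \<in> Some ` pfix X D \<alpha> n" for k
      unfolding orbit[OF x s] using x(1) V(3) pfix_funpow[OF _ n] by blast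
    then show "s \<in> pfix (rev_space X D \<alpha>) (rev_dom X D \<alpha>) (rev_map \<alpha>) n"
      unfolding pfix_rev_space[OF n] using s by blast
  qed
  ultimately show False
    using assms n unfolding topologically_free_rev_space_iff by blast
qed

end

theorem theorem5p16:
  fixes X :: "'a topology" and D :: "'a set" and \<alpha> :: "'a \<Rightarrow> 'a"
  assumes "compact_space X" and "Hausdorff_space X"
    and "openin X D" and "closedin X D"
    and "continuous_map (subtopology X D) X \<alpha>"
    and "openin X (\<alpha> ` D)"
  shows "(\<forall>n>0. pfix (rev_space X D \<alpha>) (rev_dom X D \<alpha>) (rev_map \<alpha>) n =
            {s \<in> topspace (rev_space X D \<alpha>). \<forall>k. s k \<in> Some ` pfix X D \<alpha> n})
       \<and> (topologically_free X D \<alpha> \<longleftrightarrow>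
            topologically_free (rev_space X D \<alpha>) (rev_dom X D \<alpha>) (rev_map \<alpha>))"
proof -
  have dom: "D \<subseteq> topspace X" and img: "\<alpha> ` D \<subseteq> topspace X"
    using assms(3,6) openin_subset by blast+
  show ?thesis
    using pfix_rev_space[OF dom img] topologically_free_imp_rev_space[OF dom img assms(3,5)]
      rev_space_topologically_free_imp[OF dom img] by blast
qed

end
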